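(* Let $d\ge2$ be an integer, $c\in\mathbb{R}$, and $F_{c,d}=1/Q_{c,d}$ where $Q_{c,d}(z_1,\dots,z_d)=1-e_1+c\,e_d$. If $\mathbf z\in\mathrm{crit}(1,\dots,1)$, then $z_i=z_j$ for all $1\le i,j\le d$.
   Context: $e_1=z_1+\cdots+z_d$ and $e_d=z_1z_2\cdots z_d$. Let $\mathcal V=\{\mathbf z\in\mathbb{C}^d: Q_{c,d}(\mathbf z)=0\}$, equipped with a Whitney stratification into smooth manifolds. For a direction $\hat{\mathbf r}$ in the positive orthant, $\mathrm{crit}(\hat{\mathbf r})$ is the set of $\mathbf z\in\mathcal V$ such that $\hat{\mathbf r}$ is orthogonal, in logarithmic coordinates, to the tangent space of the stratum containing $\mathbf z$. At a smooth point $\mathbf z$ of $\mathcal V$ this means that $\hat{\mathbf r}$ is parallel to the logarithmic gradient $(z_1\partial Q/\partial z_1,\dots,z_d\partial Q/\partial z_d)$ at $\mathbf z$; for $\hat{\mathbf r}=(1,\dots,1)$ this says that all entries of the logarithmic gradient at $\mathbf z$ are equal. *)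

theory Defs
  imports "HOL-Analysis.Analysis"
begin

definition Q :: "real \<Rightarrow> complex ^ 'd \<Rightarrow> complex" where
  "Q c z = 1 - (\<Sum>i\<in>UNIV. z $ i) + complex_of_real c * (\<Prod>i\<in>UNIV. z $ i)"

definition zero_set :: "(complex ^ 'd \<Rightarrow> complex) \<Rightarrow> (complex ^ 'd) set" where
  "zero_set f = {z. f z = 0}"

definition partial_deriv :: "'d \<Rightarrow> (complex ^ 'd \<Rightarrow> complex) \<Rightarrow> complex ^ 'd \<Rightarrow> complex" where
  "partial_deriv i f z = deriv (\<lambda>t. f (\<chi> j. if j = i then t else z $ j)) (z $ i)"

(* The gradient criterion presupposes that f is squarefree.  This holds for Q c: it is
   nonzero and of degree at most one in every variable, so no non-constant square divides it. *)
definition smooth_point :: "(complex ^ 'd \<Rightarrow> complex) \<Rightarrow> complex ^ 'd \<Rightarrow> bool" where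
  "smooth_point f z \<longleftrightarrow> f z = 0 \<and> (\<exists>i. partial_deriv i f z \<noteq> 0)"

(* C^k through directional derivatives, so that all iterated derivatives keep the same type;
   on open sets in finite dimension this is the usual notion. *)
primrec C_on :: "nat \<Rightarrow> 'a::euclidean_space set \<Rightarrow> ('a \<Rightarrow> 'b::real_normed_vector) \<Rightarrow> bool" where
  "C_on 0 U f \<longleftrightarrow> continuous_on U f"
| "C_on (Suc k) U f \<longleftrightarrow>
     (\<exists>f'. (\<forall>x\<in>U. (f has_derivative f' x) (at x)) \<and> (\<forall>v. C_on k U (\<lambda>x. f' x v)))"

definition smooth_on :: "'a::euclidean_space set \<Rightarrow> ('a \<Rightarrow> 'b::real_normed_vector) \<Rightarrow> bool" where
  "smooth_on U f \<longleftrightarrow> (\<forall>k. C_on k U f)"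

(* Embedded real C^infinity submanifold of dimension k, by slice charts. *)
definition smooth_submanifold :: "nat \<Rightarrow> 'a::euclidean_space set \<Rightarrow> bool" where
  "smooth_submanifold k S \<longleftrightarrow>
     (\<forall>p\<in>S. \<exists>U W \<phi> \<psi> L. open U \<and> p \<in> U \<and> open W \<and> homeomorphism U W \<phi> \<psi> \<and>
        smooth_on U \<phi> \<and> smooth_on W \<psi> \<and>
        subspace (L :: 'a set) \<and> dim L = k \<and> \<phi> ` (S \<inter> U) = L \<inter> W)"

(* Velocities of curves in S through p.  For a submanifold S a slice chart shows that
   differentiability at the single parameter value 0 already gives the usual tangent space. *)
definition tangent_space :: "'a::real_normed_vector set \<Rightarrow> 'a \<Rightarrow> 'a set" where
  "tangent_space S p =
     {v. \<exists>\<gamma>. \<gamma> (0::real) = p \<and> range \<gamma> \<subseteq> S \<and> (\<gamma> has_vector_derivative v) (at 0)}"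

(* For linear subspaces of a Euclidean space, pointwise convergence of the distance functions is
   convergence of the orthogonal projections, that is, convergence in the Grassmannian. *)
definition subspaces_tendsto :: "(nat \<Rightarrow> 'a::euclidean_space set) \<Rightarrow> 'a set \<Rightarrow> bool" where
  "subspaces_tendsto T L \<longleftrightarrow>
     subspace L \<and> (\<forall>v. (\<lambda>n. infdist v (T n)) \<longlonglongrightarrow> infdist v L)"

definition whitney_a :: "'a::euclidean_space set \<Rightarrow> 'a set \<Rightarrow> bool" where
  "whitney_a A B \<longleftrightarrow>
     (\<forall>y\<in>A. \<forall>x T. (\<forall>n. x n \<in> B) \<and> x \<longlonglongrightarrow> y \<and>
        subspaces_tendsto (\<lambda>n. tangent_space B (x n)) T \<longrightarrow> tangent_space A y \<subseteq> T)"

definition whitney_b :: "'a::euclidean_space set \<Rightarrow> 'a set \<Rightarrow> bool" where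
  "whitney_b A B \<longleftrightarrow>
     (\<forall>y\<in>A. \<forall>x a T l. (\<forall>n. x n \<in> B) \<and> (\<forall>n. a n \<in> A) \<and> x \<longlonglongrightarrow> y \<and> a \<longlonglongrightarrow> y \<and>
        subspaces_tendsto (\<lambda>n. tangent_space B (x n)) T \<and>
        subspaces_tendsto (\<lambda>n. span {x n - a n}) l \<longrightarrow> l \<subseteq> T)"

definition whitney_stratification :: "'a::euclidean_space set set \<Rightarrow> 'a set \<Rightarrow> bool" where
  "whitney_stratification \<S> V \<longleftrightarrow>
     finite \<S> \<and> partition_on V \<S> \<and>
     (\<forall>S\<in>\<S>. \<exists>k. smooth_submanifold k S) \<and>
     (\<forall>A\<in>\<S>. \<forall>B\<in>\<S>. A \<inter> closure B \<noteq> {} \<longrightarrow> A \<subseteq> closure B) \<and>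
     (\<forall>A\<in>\<S>. \<forall>B\<in>\<S>. A \<noteq> B \<longrightarrow> whitney_a A B \<and> whitney_b A B)"

(* Near a smooth point of the hypersurface f = 0, its stratum is the whole hypersurface.  An
   arbitrary Whitney stratification may be refined by superfluous strata inside the smooth locus,
   for instance by single points, which would then be critical for every direction; this condition
   excludes that, and it is what makes criticality at smooth points a condition on the gradient. *)
definition unrefined_at_smooth_points ::
    "(complex ^ 'd) set set \<Rightarrow> (complex ^ 'd \<Rightarrow> complex) \<Rightarrow> bool" where
  "unrefined_at_smooth_points \<S> f \<longleftrightarrow>
     (\<forall>S\<in>\<S>. \<forall>z\<in>S. smooth_point f z \<longrightarrow> (\<exists>U. open U \<and> z \<in> U \<and> zero_set f \<inter> U \<subseteq> S))"

(* Pullback of the tangent space under the differential w \<mapsto> (z_1 w_1, ..., z_d w_d) of the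
   coordinate change z_i = exp(\<zeta>_i).  There is no division by z_i: if z_i = 0, then the i-th axis
   belongs to this space, so that no direction with i-th entry nonzero is orthogonal to it.  At a
   smooth point, orthogonality to this space means lying in the complex span of the logarithmic
   gradient, whether or not coordinates vanish. *)
definition log_tangent_space :: "(complex ^ 'd) set \<Rightarrow> complex ^ 'd \<Rightarrow> (complex ^ 'd) set" where
  "log_tangent_space S z = {w. (\<chi> i. z $ i * w $ i) \<in> tangent_space S z}"

(* Orthogonality is with respect to the complex bilinear pairing, as for gradients. *)
definition crit :: "(complex ^ 'd) set set \<Rightarrow> real ^ 'd \<Rightarrow> (complex ^ 'd) set" where
  "crit \<S> r =
     {z. \<exists>S\<in>\<S>. z \<in> S \<and>
        (\<forall>w\<in>log_tangent_space S z. (\<Sum>i\<in>UNIV. complex_of_real (r $ i) * w $ i) = 0)}"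

end

theory Submission
  imports Defs
begin

text \<open>
  \<open>Q c\<close> is affine in each pair of variables \<open>x = z\<^sub>i\<close>, \<open>y = z\<^sub>j\<close>: it equals
  \<open>s - x - y + c p x y\<close>, where \<open>s\<close> and \<open>p\<close> depend on the other variables only.  The logarithmic
  partial derivatives are \<open>c p x y - x\<close> and \<open>c p x y - y\<close>; if both vanish, then \<open>x = y\<close> (this
  covers the singular points).  Otherwise, say, \<open>y (1 - c p x) \<noteq> 0\<close>; the point is smooth, and
  solving \<open>Q c = 0\<close> for \<open>y\<close> gives a curve in the stratum along which only \<open>x\<close> and \<open>y\<close> move.
  Orthogonality of \<open>(1,\<dots>,1)\<close> to its logarithmic velocity says \<open>x = y\<close>.
\<close>

text \<open>With base vector \<open>0\<close> the same function also writes velocities supported on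
  two coordinates.\<close>

definition upd2 :: "complex ^ 'd \<Rightarrow> 'd \<Rightarrow> complex \<Rightarrow> 'd \<Rightarrow> complex \<Rightarrow> complex ^ 'd" where
  "upd2 z i x j y = (\<chi> k. if k = i then x else if k = j then y else z $ k)"

lemma upd2_same [simp]: "upd2 z i (z $ i) j (z $ j) = z"
  by (simp add: upd2_def vec_eq_iff)

lemma Q_upd2:
  assumes "i \<noteq> j"
  shows "Q c (upd2 z i x j y) =
    1 - (\<Sum>k\<in>-{i,j}. z $ k) - x - y + complex_of_real c * (\<Prod>k\<in>-{i,j}. z $ k) * x * y"
proof -
  have UN: "UNIV = insert i (insert j (-{i,j}))"
    by auto
  have "(\<Sum>k\<in>UNIV. upd2 z i x j y $ k) = x + (y + (\<Sum>k\<in>-{i,j}. z $ k))"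
    using assms by (subst UN) (auto simp: upd2_def intro!: sum.cong)
  moreover have "(\<Prod>k\<in>UNIV. upd2 z i x j y $ k) = x * (y * (\<Prod>k\<in>-{i,j}. z $ k))"
    using assms by (subst UN) (auto simp: upd2_def intro!: prod.cong)
  ultimately show ?thesis
    by (simp add: Q_def algebra_simps)
qed

lemma partial_deriv_Q:
  assumes "i \<noteq> j"
  shows "partial_deriv j (Q c) z = complex_of_real c * (\<Prod>k\<in>-{i,j}. z $ k) * z $ i - 1"
proof -
  have "(\<chi> k. if k = j then t else z $ k) = upd2 z i (z $ i) j t" for t
    using assms by (auto simp: upd2_def vec_eq_iff)
  then show ?thesis
    unfolding partial_deriv_def
    by (auto simp: Q_upd2[OF assms] intro!: DERIV_imp_deriv derivative_eq_intros)
qed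

lemma upd2_has_vector_derivative:
  assumes "i \<noteq> j"
    and "(f has_vector_derivative a) (at t)" and "(g has_vector_derivative b) (at t)"
  shows "((\<lambda>t. upd2 z i (f t) j (g t)) has_vector_derivative upd2 0 i a j b) (at t)"
proof -
  have axis: "bounded_linear (axis k :: complex \<Rightarrow> complex ^ 'a)" for k :: 'a
    by (auto simp: axis_def vec_eq_iff linear_conv_bounded_linear[symmetric] intro!: linearI)
  \<comment> \<open>The moved entries enter affinely, so only the two axis vectors contribute to the
    velocity.\<close>
  have upd2_eq: "upd2 w i x j y = upd2 w i 0 j 0 + (axis i x + axis j y)" for w x y
    using assms(1) by (auto simp: upd2_def axis_def vec_eq_iff)
  have "upd2 0 i 0 j 0 = (0 :: complex ^ 'a)"
    by (simp add: upd2_def vec_eq_iff)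
  then have upd2_0: "upd2 0 i a j b = 0 + (axis i a + axis j b)"
    using upd2_eq[of 0 a b] by simp
  have "((\<lambda>t. upd2 z i 0 j 0 + (axis i (f t) + axis j (g t))) has_vector_derivative
      0 + (axis i a + axis j b)) (at t)"
    by (intro has_vector_derivative_add has_vector_derivative_const
        bounded_linear.has_vector_derivative[OF axis] assms(2,3))
  then show ?thesis
    by (subst upd2_0, subst upd2_eq)
qed

text \<open>A velocity depends only on the germ of the curve at 0. As \<open>tangent_space\<close>
  demands a curve that lies in \<open>S\<close> at all times, the curve is reset to \<open>p\<close>
  wherever it leaves \<open>S\<close>.\<close>

lemma tangent_spaceI:
  assumes "\<gamma> 0 = p" "p \<in> S" "\<forall>\<^sub>F t in at 0. \<gamma> t \<in> S" "(\<gamma> has_vector_derivative v) (at 0)"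
  shows "v \<in> tangent_space S p"
proof -
  define \<gamma>' where "\<gamma>' t = (if \<gamma> t \<in> S then \<gamma> t else p)" for t
  have "\<forall>\<^sub>F t in nhds 0. t \<in> UNIV \<longrightarrow> \<gamma> t = \<gamma>' t"
    using assms by (auto simp: \<gamma>'_def eventually_at_filter elim: eventually_mono)
  then have "(\<gamma>' has_vector_derivative v) (at 0)"
    using assms(1,2,4) by (subst (asm) has_vector_derivative_cong_ev) (auto simp: \<gamma>'_def)
  moreover have "\<gamma>' 0 = p" "range \<gamma>' \<subseteq> S"
    using assms by (auto simp: \<gamma>'_def)
  ultimately show ?thesis
    unfolding tangent_space_def by blast
qed

text \<open>The factors in \<open>nz\<close> have separate uses: \<open>1 - p i j * z $ i\<close> is
  minus the partial derivative in coordinate \<open>j\<close>, which gives smoothness and lets the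
  equation be solved for that coordinate; \<open>z $ j\<close> is divided by in the logarithmic
  velocity. The entry \<open>z $ i\<close> may vanish.\<close>

lemma crit_diagonal_coords_eq:
  fixes c :: real and z :: "complex ^ 'd"
  defines "p \<equiv> \<lambda>i j. complex_of_real c * (\<Prod>k\<in>-{i,j}. z $ k)"
  assumes part: "partition_on (zero_set (Q c)) \<S>"
    and unref: "unrefined_at_smooth_points \<S> (Q c)"
    and crit: "z \<in> crit \<S> (\<chi> i. 1)"
    and ij: "i \<noteq> j" and nz: "z $ j * (1 - p i j * z $ i) \<noteq> 0"
  shows "z $ i = z $ j"
proof -
  obtain S where S: "S \<in> \<S>" "z \<in> S"
    and orth: "\<And>w. w \<in> log_tangent_space S z \<Longrightarrow> (\<Sum>k\<in>UNIV. w $ k) = 0"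
    using crit by (auto simp: crit_def)
  define s where "s = 1 - (\<Sum>k\<in>-{i,j}. z $ k)"
  define P where "P = p i j"
  define u where "u = 1 - P * z $ i"
  have Q_eq: "Q c (upd2 z i x j y) = s - x - y + P * x * y" for x y
    by (simp add: Q_upd2[OF ij] s_def P_def p_def)
  have u: "u \<noteq> 0" and zj: "z $ j \<noteq> 0"
    using nz by (auto simp: u_def P_def)
  have Qz: "Q c z = 0"
    using part S by (auto simp: partition_on_def zero_set_def)
  then have s_eq: "s - z $ i = z $ j * u"
    using Q_eq[of "z $ i" "z $ j"] by (simp add: u_def algebra_simps)
  have "smooth_point (Q c) z"
    using Qz u partial_deriv_Q[OF ij, of c z]
    by (auto simp: smooth_point_def u_def P_def p_def intro!: exI[of _ j])
  then obtain U where U: "open U" "z \<in> U" "zero_set (Q c) \<inter> U \<subseteq> S"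
    using unref S unfolding unrefined_at_smooth_points_def by blast
  \<comment> \<open>With \<open>x = z $ i * (1 + t)\<close>, \<open>h t\<close> is the solution
    \<open>(s - x) / (1 - P * x)\<close> of the equation. This choice of \<open>x\<close> allows
    logarithmic velocity 1 in coordinate \<open>i\<close>, even if \<open>z $ i = 0\<close>.\<close>
  define h where "h t = (s - z $ i - of_real t * z $ i) / (u - P * z $ i * of_real t)" for t
  define \<gamma> where "\<gamma> t = upd2 z i (z $ i + of_real t * z $ i) j (h t)" for t :: real
  \<comment> \<open>The derivative of \<open>h\<close> at 0, after \<open>s_eq\<close> cancels one
    factor \<open>u\<close>.\<close>
  define b where "b = - z $ i * (1 - P * z $ j) / u"
  have h0: "h 0 = z $ j"
    using u by (simp add: h_def s_eq)
  then have \<gamma>0: "\<gamma> 0 = z"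
    by (simp add: \<gamma>_def)
  have "((\<lambda>w. (s - z $ i - w * z $ i) / (u - P * z $ i * w)) has_field_derivative
      ((- z $ i) * u - (s - z $ i) * (- (P * z $ i))) / (u * u)) (at (of_real 0))"
    using u by (auto intro!: derivative_eq_intros)
  then have "(h has_vector_derivative
      ((- z $ i) * u - (s - z $ i) * (- (P * z $ i))) / (u * u)) (at 0)"
    unfolding h_def by (rule has_vector_derivative_real_field)
  also have "((- z $ i) * u - (s - z $ i) * (- (P * z $ i))) / (u * u) = b"
    using u by (simp add: s_eq b_def field_simps)
  finally have dh: "(h has_vector_derivative b) (at 0)" .
  have "((\<lambda>t. z $ i + of_real t * z $ i) has_vector_derivative z $ i) (at 0)"
    by (auto intro!: derivative_eq_intros)
  then have d\<gamma>: "(\<gamma> has_vector_derivative upd2 0 i (z $ i) j b) (at 0)"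
    unfolding \<gamma>_def using dh by (rule upd2_has_vector_derivative[OF ij])
  have "\<gamma> \<midarrow>0\<rightarrow> z"
    using has_vector_derivative_continuous[OF d\<gamma>] \<gamma>0 by (simp add: continuous_at)
  then have evU: "\<forall>\<^sub>F t in at 0. \<gamma> t \<in> U"
    using U(1,2) by (rule topological_tendstoD)
  have "((\<lambda>t. u - P * z $ i * of_real t) \<longlongrightarrow> u - P * z $ i * of_real 0) (at (0::real))"
    by (intro tendsto_intros)
  then have ev: "\<forall>\<^sub>F t in at (0::real). u - P * z $ i * of_real t \<noteq> 0"
    using u by (intro tendsto_imp_eventually_ne) auto
  \<comment> \<open>The curve stays on the hypersurface while the denominator of \<open>h\<close> is
    nonzero; inside \<open>U\<close> this puts it in the stratum.\<close>
  have "\<forall>\<^sub>F t in at 0. \<gamma> t \<in> S"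
    using evU ev
  proof eventually_elim
    case (elim t)
    let ?x = "z $ i + of_real t * z $ i"
    have "u - P * z $ i * of_real t = 1 - P * ?x"
      by (simp add: u_def algebra_simps)
    then have "h t * (1 - P * ?x) = s - ?x"
      using elim(2) by (simp add: h_def)
    then have "Q c (\<gamma> t) = 0"
      by (simp add: \<gamma>_def Q_eq algebra_simps)
    then show ?case
      using elim(1) U(3) by (auto simp: zero_set_def)
  qed
  then have tangent: "upd2 0 i (z $ i) j b \<in> tangent_space S z"
    using \<gamma>0 S(2) d\<gamma> by (intro tangent_spaceI)
  have "(\<chi> k. z $ k * upd2 0 i 1 j (b / z $ j) $ k) = upd2 0 i (z $ i) j b"
    using zj by (auto simp: upd2_def vec_eq_iff)
  then have "upd2 0 i 1 j (b / z $ j) \<in> log_tangent_space S z"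
    using tangent by (simp add: log_tangent_space_def)
  then have "(\<Sum>k\<in>UNIV. upd2 0 i 1 j (b / z $ j) $ k) = 0"
    by (rule orth)
  also have "(\<Sum>k\<in>UNIV. upd2 0 i 1 j (b / z $ j) $ k) = (\<Sum>k\<in>{i,j}. upd2 0 i 1 j (b / z $ j) $ k)"
    by (rule sum.mono_neutral_right) (auto simp: upd2_def)
  also have "\<dots> = 1 + b / z $ j"
    using ij by (simp add: upd2_def)
  finally have "z $ j * u = z $ i * (1 - P * z $ j)"
    using u zj by (simp add: b_def field_simps)
  \<comment> \<open>The terms \<open>P * z $ i * z $ j\<close> on the two sides cancel.\<close>
  then show ?thesis
    by (simp add: u_def algebra_simps)
qed

theorem lemma18:
  fixes c :: real and z :: "complex ^ 'd" and \<S> :: "(complex ^ 'd) set set"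
  assumes "CARD('d) \<ge> 2"
    and "whitney_stratification \<S> (zero_set (Q c))"
    and "unrefined_at_smooth_points \<S> (Q c)"
    and "z \<in> crit \<S> (\<chi> i. 1)"
  shows "\<forall>i j. z $ i = z $ j"
proof (intro allI)
  fix i j
  have part: "partition_on (zero_set (Q c)) \<S>"
    using assms(2) by (simp add: whitney_stratification_def)
  let ?p = "complex_of_real c * (\<Prod>k\<in>-{i,j}. z $ k)"
  have "-{j,i} = -{i,j}"
    by auto
  \<comment> \<open>The third case is written with \<open>-{j,i}\<close> to match the lemma with
    \<open>i\<close> and \<open>j\<close> exchanged.\<close>
  then consider "i = j" | "i \<noteq> j" "z $ j * (1 - ?p * z $ i) \<noteq> 0"
    | "i \<noteq> j" "z $ i * (1 - complex_of_real c * (\<Prod>k\<in>-{j,i}. z $ k) * z $ j) \<noteq> 0"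
    | "z $ j * (1 - ?p * z $ i) = 0" "z $ i * (1 - ?p * z $ j) = 0"
    by metis
  then show "z $ i = z $ j"
  proof cases
    case 2
    then show ?thesis
      using crit_diagonal_coords_eq[OF part assms(3,4)] by blast
  next
    case 3
    then show ?thesis
      using crit_diagonal_coords_eq[OF part assms(3,4), of j i] by simp
  next
    case 4
    then have "z $ j = ?p * z $ i * z $ j" "z $ i = ?p * z $ i * z $ j"
      by (simp_all only: right_diff_distrib right_minus_eq mult_1_left mult_1_right ac_simps)
    then show ?thesis
      by metis
  qed simp
qed

end
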